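(* Let $V\subset\mathbb{P}^2$ be a plane curve defined over $\mathbb{R}$, let $L_0\subset L_1\subset\mathbb{P}^2$ be a flag defined over $\mathbb{R}$ consisting of a point $L_0$ and a line $L_1$ (the line at infinity), and let $S=V\cap\mathbb{A}^2$, where $\mathbb{A}^2=\mathbb{P}^2\setminus L_1$. Suppose that $S_{\mathbb{R}}$ is non-empty and compact and has only ordinary real multiple points as singularities. Then the polar variety $W_{L_0}(S_{\mathbb{R}})$ contains at least one non-singular point of each connected component of $S_{\mathbb{R}}$.
   Context: Curves are complex algebraic varieties (zero sets of polynomials, possibly reducible). $S_{\mathbb{R}}$ denotes the set of real points of $S$, with the Euclidean topology (compactness and connected components are meant in this topology). $S_{\mathrm{ns}}$ denotes the set of non-singular points of $S$; a singularity of $S_{\mathbb{R}}$ is a point of $S_{\mathbb{R}}$ that is not in $S_{\mathrm{ns}}$, and a non-singular point of $S_{\mathbb{R}}$ is a point of $S_{\mathbb{R}}\cap S_{\mathrm{ns}}$. For $P\in S_{\mathrm{ns}}$, $t_PS$ denotes the affine tangent line to $S$ at $P$ translated to the origin, regarded as a linear subspace of $\mathbb{A}^2$ (viewed as a vector space). Let $I_1\subset\mathbb{A}^2$ be the line through the origin with point at infinity $L_0$ (the affine cone over $L_0$). The affine polar variety of $S$ with respect to the flag is $W_{L_0}(S)=\{P\in S_{\mathrm{ns}} \mid t_PS=I_1\}$, and $W_{L_0}(S_{\mathbb{R}})$ is its set of real points. An ordinary real multiple point is a singular point with at least two real branches, such that the tangent lines intersect pairwise transversally.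
   Formalization: An ordinary real multiple point is additionally required to have all its real branches smooth; if cuspidal real branches with transversal tangent lines were allowed, the claim would be false. *)

theory Defs
  imports "HOL-Analysis.Analysis" "HOL-Library.Poly_Mapping"
begin

text \<open>
  A polynomial over \<open>'a\<close> in variables indexed by \<open>'n\<close> is a finitely supported family of
  coefficients, indexed by monomials, which are finitely supported families of exponents.
\<close>

type_synonym ('n, 'a) mpolynomial = "('n \<Rightarrow>\<^sub>0 nat) \<Rightarrow>\<^sub>0 'a"

definition mp_eval :: "('n::finite, 'a::comm_ring_1) mpolynomial \<Rightarrow> 'a ^ 'n \<Rightarrow> 'a" where
  "mp_eval f x =
     (\<Sum>m\<in>Poly_Mapping.keys f.
        Poly_Mapping.lookup f m * (\<Prod>i\<in>UNIV. (x $ i) ^ Poly_Mapping.lookup m i))"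

definition mp_homogeneous :: "nat \<Rightarrow> ('n::finite, 'a::comm_ring_1) mpolynomial \<Rightarrow> bool" where
  "mp_homogeneous d f \<longleftrightarrow>
     (\<forall>m\<in>Poly_Mapping.keys f. (\<Sum>i\<in>UNIV. Poly_Mapping.lookup m i) = d)"

definition cvec :: "real ^ 'n \<Rightarrow> complex ^ 'n" where
  "cvec x = (\<chi> i. of_real (x $ i))"

definition cmat :: "real ^ 'n ^ 'm \<Rightarrow> complex ^ 'n ^ 'm" where
  "cmat A = (\<chi> i. cvec (A $ i))"


subsection \<open>The complex projective plane\<close>

text \<open>A point of the projective plane is a one-dimensional subspace of \<open>complex ^ 3\<close>.\<close>

type_synonym proj_pt = "(complex ^ 3) set"

definition proj_class :: "complex ^ 3 \<Rightarrow> proj_pt" where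
  "proj_class v = vec.span {v}"

definition proj_plane :: "proj_pt set" where
  "proj_plane = {proj_class v | v. v \<noteq> 0}"

definition real_proj_point :: "proj_pt \<Rightarrow> bool" where
  "real_proj_point p \<longleftrightarrow> (\<exists>w :: real ^ 3. w \<noteq> 0 \<and> p = proj_class (cvec w))"

definition real_proj_line :: "proj_pt set \<Rightarrow> bool" where
  "real_proj_line L \<longleftrightarrow>
     (\<exists>l :: real ^ 3. l \<noteq> 0 \<and>
        L = {proj_class v | v. v \<noteq> 0 \<and> (\<Sum>i\<in>UNIV. cvec l $ i * v $ i) = 0})"

text \<open>
  A plane curve is the zero set of a single non-constant form, so it has pure dimension one.
  The form need be neither irreducible nor squarefree; only its zero set matters below.
\<close>

definition real_plane_curve :: "proj_pt set \<Rightarrow> bool" where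
  "real_plane_curve V \<longleftrightarrow>
     (\<exists>(F :: (3, complex) mpolynomial) d.
        0 < d \<and> F \<noteq> 0 \<and> mp_homogeneous d F \<and>
        (\<forall>m. Poly_Mapping.lookup F m \<in> \<real>) \<and>
        V = {proj_class v | v. v \<noteq> 0 \<and> mp_eval F v = 0})"


subsection \<open>The affine plane\<close>

text \<open>
  The complement of a real line is identified with \<open>complex ^ 2\<close> by real affine coordinates:
  an invertible real matrix \<open>A\<close> sends \<open>(x, y)\<close> to the point with homogeneous coordinates
  \<open>A (x, y, 1)\<close>.  The direction \<open>(x, y)\<close> then has the point at infinity \<open>A (x, y, 0)\<close>.
\<close>

definition affine_chart :: "real ^ 3 ^ 3 \<Rightarrow> complex ^ 2 \<Rightarrow> proj_pt" where
  "affine_chart A p = proj_class (cmat A *v vector [p $ 1, p $ 2, 1])"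

definition point_at_infinity :: "real ^ 3 ^ 3 \<Rightarrow> complex ^ 2 \<Rightarrow> proj_pt" where
  "point_at_infinity A v = proj_class (cmat A *v vector [v $ 1, v $ 2, 0])"

definition affine_coordinates :: "real ^ 3 ^ 3 \<Rightarrow> proj_pt set \<Rightarrow> bool" where
  "affine_coordinates A L \<longleftrightarrow> invertible A \<and> range (affine_chart A) = proj_plane - L"

definition affine_part :: "real ^ 3 ^ 3 \<Rightarrow> proj_pt set \<Rightarrow> (complex ^ 2) set" where
  "affine_part A V = {p. affine_chart A p \<in> V}"

definition cone_line :: "real ^ 3 ^ 3 \<Rightarrow> proj_pt \<Rightarrow> (complex ^ 2) set" where
  "cone_line A L0 = {v. v = 0 \<or> point_at_infinity A v = L0}"

definition real_points :: "(complex ^ 2) set \<Rightarrow> (real ^ 2) set" where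
  "real_points S = {x. cvec x \<in> S}"


subsection \<open>Tangent lines, non-singular points, polar varieties\<close>

definition vanishing_ideal :: "(complex ^ 2) set \<Rightarrow> (2, complex) mpolynomial set" where
  "vanishing_ideal S = {f. \<forall>p\<in>S. mp_eval f p = 0}"

text \<open>The common kernel of the differentials at \<open>P\<close> of all polynomials vanishing on \<open>S\<close>.\<close>

definition tangent_space :: "(complex ^ 2) set \<Rightarrow> complex ^ 2 \<Rightarrow> (complex ^ 2) set" where
  "tangent_space S P =
     {v. \<forall>f\<in>vanishing_ideal S. deriv (\<lambda>t. mp_eval f (P + t *s v)) 0 = 0}"

text \<open>The dimension is over the complex numbers; the value 1 is the dimension of a curve.\<close>

definition nonsingular_points :: "(complex ^ 2) set \<Rightarrow> (complex ^ 2) set" where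
  "nonsingular_points S = {P \<in> S. vec.dim (tangent_space S P) = 1}"

definition polar_variety :: "real ^ 3 ^ 3 \<Rightarrow> proj_pt \<Rightarrow> (complex ^ 2) set \<Rightarrow> (complex ^ 2) set" where
  "polar_variety A L0 S = {P \<in> nonsingular_points S. tangent_space S P = cone_line A L0}"


subsection \<open>Branches\<close>

text \<open>
  A branch of \<open>S\<close> at \<open>P\<close> is a class of injective convergent power series parametrizations
  centred at \<open>P\<close>, up to an invertible change of parameter.  Injectivity near the centre
  excludes constant parametrizations and those that factor through a power of the parameter.
\<close>

definition curve_germ :: "complex fps ^ 2 \<Rightarrow> complex \<Rightarrow> complex ^ 2" where
  "curve_germ g t = (\<chi> i. eval_fps (g $ i) t)"

definition branch_param :: "(complex ^ 2) set \<Rightarrow> complex ^ 2 \<Rightarrow> complex fps ^ 2 \<Rightarrow> bool" where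
  "branch_param S P g \<longleftrightarrow>
     (\<forall>i. fps_conv_radius (g $ i) > 0) \<and>
     (\<forall>i. fps_nth (g $ i) 0 = P $ i) \<and>
     (\<exists>r>0. inj_on (curve_germ g) (ball 0 r) \<and> curve_germ g ` ball 0 r \<subseteq> S)"

definition reparam :: "(complex fps ^ 2) rel" where
  "reparam =
     {(g, g'). \<exists>h. fps_conv_radius h > 0 \<and> fps_nth h 0 = 0 \<and> fps_nth h 1 \<noteq> 0 \<and>
        (\<forall>i. g' $ i = fps_compose (g $ i) h)}"

definition branches :: "(complex ^ 2) set \<Rightarrow> complex ^ 2 \<Rightarrow> (complex fps ^ 2) set set" where
  "branches S P =
     {g. branch_param S P g} // (reparam \<inter> {g. branch_param S P g} \<times> {g. branch_param S P g})"

definition real_branches :: "(complex ^ 2) set \<Rightarrow> complex ^ 2 \<Rightarrow> (complex fps ^ 2) set set" where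
  "real_branches S P = {B \<in> branches S P. \<exists>g\<in>B. \<forall>i n. fps_nth (g $ i) n \<in> \<real>}"

definition param_mult :: "complex fps ^ 2 \<Rightarrow> nat" where
  "param_mult g = (LEAST k. 0 < k \<and> (\<exists>i. fps_nth (g $ i) k \<noteq> 0))"

definition param_tangent :: "complex fps ^ 2 \<Rightarrow> (complex ^ 2) set" where
  "param_tangent g = vec.span {\<chi> i. fps_nth (g $ i) (param_mult g)}"

text \<open>Multiplicity and tangent line do not depend on the representative of the branch.\<close>

definition smooth_branch :: "(complex fps ^ 2) set \<Rightarrow> bool" where
  "smooth_branch B \<longleftrightarrow> (\<forall>g\<in>B. param_mult g = 1)"

definition transversal_branches :: "(complex fps ^ 2) set \<Rightarrow> (complex fps ^ 2) set \<Rightarrow> bool" where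
  "transversal_branches B B' \<longleftrightarrow>
     (\<forall>g\<in>B. \<forall>g'\<in>B'. vec.span (param_tangent g \<union> param_tangent g') = UNIV)"

text \<open>
  As usual for ordinary multiple points, the branches are smooth: two cusps with distinct tangents
  do not form one.  Only the real branches are constrained; non-real branches may also be present.
\<close>

definition ordinary_real_multiple_point :: "(complex ^ 2) set \<Rightarrow> complex ^ 2 \<Rightarrow> bool" where
  "ordinary_real_multiple_point S P \<longleftrightarrow>
     P \<in> S - nonsingular_points S \<and>
     (\<exists>B\<in>real_branches S P. \<exists>B'\<in>real_branches S P. B \<noteq> B') \<and>
     (\<forall>B\<in>real_branches S P. smooth_branch B) \<and>
     pairwise transversal_branches (real_branches S P)"

end

theory Submission
  imports Defs "HOL-Complex_Analysis.Great_Picard"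
begin

text \<open>
  Let \<open>u\<close> be the real direction of \<open>L0\<close> and let \<open>w\<close> be orthogonal to \<open>u\<close>. A maximum \<open>x\<close> of the
  linear form \<open>w\<close> on a component \<open>C\<close> lies in the polar variety. If \<open>x\<close> were singular, \<open>w\<close> would
  have a local maximum along every real branch, so all tangents of real branches would be
  parallel to \<open>u\<close>, which transversality excludes. If \<open>x\<close> is non-singular and \<open>u\<close> is not tangent,
  some \<open>g\<close> in the ideal of \<open>S\<close> has non-zero derivative along \<open>u\<close>. The lines parallel to \<open>u\<close>
  near \<open>x\<close> then meet \<open>S\<close> near \<open>x\<close>: at least once by Hurwitz's theorem for the equation of \<open>S\<close>,
  at most once because of \<open>g\<close>, hence in a real point. These points form a path in \<open>C\<close> along
  which \<open>w\<close> exceeds its maximum.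
\<close>

section \<open>Roots of continuous families of entire functions\<close>

text \<open>Otherwise parameters tending to 0 would give functions without zeros on the ball. They
  converge locally uniformly to \<open>f 0\<close>, which \<open>nz\<close> keeps from being
  constant, so Hurwitz's theorem would make \<open>f 0\<close> zero-free as well, although it
  vanishes at \<open>z0\<close>.\<close>

lemma root_persistence:
  fixes f :: "real \<Rightarrow> complex \<Rightarrow> complex"
  assumes cont: "continuous_on UNIV (\<lambda>p. f (fst p) (snd p))"
    and hol: "\<And>s. f s holomorphic_on UNIV"
    and zero: "f 0 z0 = 0" and e: "0 < e"
    and nz: "\<exists>z\<in>ball z0 e. f 0 z \<noteq> 0"
  shows "\<exists>d>0. \<forall>s. \<bar>s\<bar> < d \<longrightarrow> (\<exists>z\<in>ball z0 e. f s z = 0)"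
proof (rule ccontr)
  assume neg: "\<not> ?thesis"
  have "\<exists>s. \<bar>s\<bar> < inverse (real (Suc n)) \<and> (\<forall>z\<in>ball z0 e. f s z \<noteq> 0)" for n
    using neg by (metis inverse_positive_iff_positive of_nat_0_less_iff zero_less_Suc)
  then obtain \<sigma> where \<sigma>: "\<And>n. \<bar>\<sigma> n\<bar> < inverse (real (Suc n))"
    and no_root: "\<And>n z. z \<in> ball z0 e \<Longrightarrow> f (\<sigma> n) z \<noteq> 0"
    by metis
  have \<sigma>0: "\<sigma> \<longlonglongrightarrow> 0"
    by (rule Lim_null_comparison[OF _ LIMSEQ_inverse_real_of_nat])
      (use \<sigma> in \<open>auto intro!: always_eventually less_imp_le\<close>)
  have "f 0 z0 \<noteq> 0"
  proof (rule Hurwitz_no_zeros[of "ball z0 e" "\<lambda>n. f (\<sigma> n)" "f 0"])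
    show "uniform_limit K (\<lambda>n. f (\<sigma> n)) (f 0) sequentially" if "compact K" for K
    proof (rule uniform_limitI)
      fix \<epsilon> :: real assume "0 < \<epsilon>"
      \<comment> \<open>Joint continuity is uniform on a compact set, so the parameter is confined
        to \<open>cball 0 1\<close>; this is the 1 in \<open>min d 1\<close> below.\<close>
      have "uniformly_continuous_on (cball 0 1 \<times> K) (\<lambda>p. f (fst p) (snd p))"
        by (intro compact_uniformly_continuous continuous_on_subset[OF cont] compact_Times that) auto
      then obtain d where d: "d > 0"
        and close: "\<And>p q. p \<in> cball 0 1 \<times> K \<Longrightarrow> q \<in> cball 0 1 \<times> K \<Longrightarrow> dist q p < d
                  \<Longrightarrow> dist (f (fst q) (snd q)) (f (fst p) (snd p)) < \<epsilon>"
        using \<open>0 < \<epsilon>\<close> unfolding uniformly_continuous_on_def by metis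
      have "\<forall>\<^sub>F n in sequentially. dist (\<sigma> n) 0 < min d 1"
        using \<sigma>0 d by (intro tendstoD) auto
      then show "\<forall>\<^sub>F n in sequentially. \<forall>z\<in>K. dist (f (\<sigma> n) z) (f 0 z) < \<epsilon>"
      proof eventually_elim
        case (elim n)
        show ?case
        proof
          fix z assume "z \<in> K"
          then show "dist (f (\<sigma> n) z) (f 0 z) < \<epsilon>"
            using close[of "(0, z)" "(\<sigma> n, z)"] elim by (auto simp: dist_Pair_Pair)
        qed
      qed
    qed
    show "\<not> f 0 constant_on ball z0 e"
      using nz zero e unfolding constant_on_def by (metis centre_in_ball)
  qed (use e no_root in \<open>auto intro: holomorphic_on_subset[OF hol]\<close>)
  then show False using zero by simp
qed

text \<open>
  The point of taking \<open>G\<close> apart from \<open>f\<close>: the roots of \<open>f s\<close> may be multiple, and it is only the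
  simple roots of \<open>G s\<close> that make them unique. Uniqueness forces them to be real.
\<close>

lemma real_root_path:
  fixes f G D :: "real \<Rightarrow> complex \<Rightarrow> complex"
  assumes f_cont: "continuous_on UNIV (\<lambda>p. f (fst p) (snd p))"
    and f_hol: "\<And>s. f s holomorphic_on UNIV"
    and f_cnj: "\<And>s t. f s t = 0 \<Longrightarrow> f s (cnj t) = 0"
    and f_zero: "f 0 0 = 0"
    and f_G: "\<And>s t. f s t = 0 \<Longrightarrow> G s t = 0"
    and G_cont: "\<And>t. continuous_on UNIV (\<lambda>s. G s t)"
    and G_deriv: "\<And>s t. (G s has_field_derivative D s t) (at t)"
    and D_cont: "continuous_on UNIV (\<lambda>p. D (fst p) (snd p))"
    and D_nz: "D 0 0 \<noteq> 0"
  obtains \<delta> and \<tau> :: "real \<Rightarrow> real"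
  where "0 < \<delta>" "continuous_on {0..\<delta>} \<tau>" "\<tau> 0 = 0" "\<And>s. s \<in> {0..\<delta>} \<Longrightarrow> f s (of_real (\<tau> s)) = 0"
proof -
  \<comment> \<open>The linear part \<open>D 0 0 * t\<close> expands distances by
    \<open>2 * c\<close>. Keeping \<open>D\<close> within \<open>c\<close> of \<open>D 0 0\<close>
    leaves an expansion by at least \<open>c\<close>.\<close>
  define c where "c = norm (D 0 0) / 2"
  have c: "0 < c" using D_nz by (simp add: c_def)
  have "continuous (at (0, 0)) (\<lambda>p. D (fst p) (snd p))"
    using D_cont by (simp add: continuous_on_eq_continuous_at)
  then have "\<exists>r0>0. \<forall>p. dist p (0, 0) < r0 \<longrightarrow> dist (D (fst p) (snd p)) (D 0 0) < c"
    using c by (simp add: continuous_at_eps_delta)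
  then obtain r0 where r0: "r0 > 0"
    and D_near0: "\<And>p. dist p (0, 0) < r0 \<Longrightarrow> dist (D (fst p) (snd p)) (D 0 0) < c"
    by blast
  \<comment> \<open>Halving makes the sum of the two coordinate norms, which dominates the product
    distance, less than \<open>r0\<close>.\<close>
  define r where "r = r0 / 2"
  have r: "r > 0" using r0 by (simp add: r_def)
  have D_near: "norm (D s t - D 0 0) \<le> c" if "\<bar>s\<bar> < r" "t \<in> ball 0 r" for s t
  proof -
    have "dist (s, t) (0, 0) \<le> \<bar>s\<bar> + norm t"
      by (simp add: dist_Pair_Pair sqrt_sum_squares_le_sum)
        (metis abs_ge_zero norm_ge_zero power2_abs sqrt_sum_squares_le_sum)
    also have "\<dots> < r0" using that by (simp add: r_def)
    finally show ?thesis using D_near0[of "(s, t)"] by (simp add: dist_norm less_imp_le)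
  qed
  \<comment> \<open>Quantitative injectivity: after subtraction of the linear part,
    \<open>G s\<close> has derivative at most \<open>c\<close> in norm and is
    \<open>c\<close>-Lipschitz. The bound yields both the uniqueness of roots and their continuity
    in \<open>s\<close>.\<close>
  have G_bound: "c * norm (t - t') \<le> norm (G s t - G s t')"
    if s: "\<bar>s\<bar> < r" and t: "t \<in> ball 0 r" "t' \<in> ball 0 r" for s t t'
  proof -
    have "norm ((G s t - D 0 0 * t) - (G s t' - D 0 0 * t')) \<le> c * norm (t - t')"
    proof (rule field_differentiable_bound[of "ball 0 r" _ "\<lambda>z. D s z - D 0 0"])
      fix z :: complex
      show "((\<lambda>z. G s z - D 0 0 * z) has_field_derivative D s z - D 0 0) (at z within ball 0 r)"
        by (rule has_field_derivative_at_within) (auto intro!: derivative_eq_intros G_deriv)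
    qed (use D_near s t in auto)
    moreover have "norm (D 0 0 * (t - t')) = 2 * (c * norm (t - t'))"
      by (simp add: c_def norm_mult)
    moreover have "norm (D 0 0 * (t - t')) \<le>
        norm (G s t - G s t') + norm ((G s t - D 0 0 * t) - (G s t' - D 0 0 * t'))"
      using norm_triangle_ineq4[of "G s t - G s t'" "(G s t - D 0 0 * t) - (G s t' - D 0 0 * t')"]
      by (simp add: algebra_simps)
    ultimately show ?thesis by linarith
  qed
  have unique: "t = t'" if "\<bar>s\<bar> < r" "t \<in> ball 0 r" "t' \<in> ball 0 r" "f s t = 0" "f s t' = 0" for s t t'
    using G_bound[OF that(1-3)] f_G that(4,5) c by (auto simp: mult_le_0_iff)
  \<comment> \<open>Any point of the disc other than the root 0 would do here, by
    uniqueness.\<close>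
  have "\<exists>z\<in>ball 0 r. f 0 z \<noteq> 0"
    using unique[of 0 0 "of_real (r/2)"] f_zero r by (intro bexI[of _ "of_real (r/2)"]) auto
  from root_persistence[OF f_cont f_hol f_zero r this] obtain d
    where d: "d > 0" and root: "\<And>s. \<bar>s\<bar> < d \<Longrightarrow> \<exists>z\<in>ball 0 r. f s z = 0" by blast
  define \<delta> where "\<delta> = min d r / 2"
  have \<delta>: "\<delta> > 0" "\<And>s. s \<in> {0..\<delta>} \<Longrightarrow> \<bar>s\<bar> < d \<and> \<bar>s\<bar> < r"
    using d r by (auto simp: \<delta>_def)
  obtain \<rho> where \<rho>: "\<And>s. s \<in> {0..\<delta>} \<Longrightarrow> \<rho> s \<in> ball 0 r \<and> f s (\<rho> s) = 0"
    using root \<delta> by metis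
  have real: "of_real (Re (\<rho> s)) = \<rho> s" if "s \<in> {0..\<delta>}" for s
  proof -
    \<comment> \<open>The disc is centred at 0, so conjugation preserves it and yields a second root
      there unless the root is real.\<close>
    have "cnj (\<rho> s) = \<rho> s"
      using unique[of s "cnj (\<rho> s)" "\<rho> s"] \<rho>[OF that] \<delta>(2)[OF that] f_cnj by auto
    then show ?thesis by (simp add: complex_eq_iff)
  qed
  \<comment> \<open>As \<open>G s'\<close> vanishes at \<open>\<rho> s'\<close>,
    \<open>G_bound\<close> controls \<open>\<rho> s' - \<rho> s\<close> by the value of
    \<open>G s'\<close> at the fixed point \<open>\<rho> s\<close>. That value tends to
    \<open>G s (\<rho> s) = 0\<close>.\<close>
  have "continuous_on {0..\<delta>} \<rho>"
    unfolding continuous_on_def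
  proof
    fix s assume s: "s \<in> {0..\<delta>}"
    have "((\<lambda>s'. G s' (\<rho> s)) \<longlongrightarrow> G s (\<rho> s)) (at s within {0..\<delta>})"
      using continuous_on_subset[OF G_cont[of "\<rho> s"], of "{0..\<delta>}"] s by (auto simp: continuous_on_def)
    then have lim: "((\<lambda>s'. norm (G s' (\<rho> s)) / c) \<longlongrightarrow> 0) (at s within {0..\<delta>})"
      using f_G[of s "\<rho> s"] \<rho>[OF s] c by (auto intro!: tendsto_eq_intros)
    have "((\<lambda>s'. \<rho> s' - \<rho> s) \<longlongrightarrow> 0) (at s within {0..\<delta>})"
    proof (rule Lim_null_comparison[OF _ lim])
      have "norm (\<rho> s' - \<rho> s) \<le> norm (G s' (\<rho> s)) / c" if s': "s' \<in> {0..\<delta>}" for s'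
        using G_bound[of s' "\<rho> s'" "\<rho> s"] \<rho>[OF s'] \<rho>[OF s] \<delta>(2)[OF s'] f_G[of s' "\<rho> s'"] c
        by (simp add: field_simps)
      then show "\<forall>\<^sub>F s' in at s within {0..\<delta>}. norm (\<rho> s' - \<rho> s) \<le> norm (G s' (\<rho> s)) / c"
        by (auto simp: eventually_at_filter)
    qed
    then show "(\<rho> \<longlongrightarrow> \<rho> s) (at s within {0..\<delta>})" by (simp add: LIM_zero_iff)
  qed
  then have "continuous_on {0..\<delta>} (\<lambda>s. Re (\<rho> s))" by (intro continuous_intros)
  moreover have "Re (\<rho> 0) = 0"
    using unique[of 0 "\<rho> 0" 0] \<rho>[of 0] \<delta>(1) r f_zero by auto
  ultimately show thesis
    using that[of \<delta> "\<lambda>s. Re (\<rho> s)"] \<delta>(1) \<rho> real by auto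
qed

section \<open>Homogeneous coordinates, the affine equation and the direction of
  \<open>L0\<close>\<close>

lemma cmat_mult_cvec: "cmat A *v cvec x = cvec (A *v x)"
  by (simp add: vec_eq_iff cmat_def cvec_def matrix_vector_mult_def)

lemma cmat_mult: "cmat A ** cmat B = cmat (A ** B)"
  by (simp add: vec_eq_iff cmat_def cvec_def matrix_matrix_mult_def)

lemma cmat_mat_1: "cmat (mat 1) = mat 1"
  by (simp add: vec_eq_iff cmat_def cvec_def mat_def)

lemma invertible_cmat: "invertible A \<Longrightarrow> invertible (cmat A)"
  unfolding invertible_def by (metis cmat_mult cmat_mat_1)

lemma invertible_mult_eq_0_iff:
  fixes M :: "'a::field ^ 'n ^ 'n"
  assumes "invertible M"
  shows "M *v v = 0 \<longleftrightarrow> v = 0"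
proof
  obtain N where "N ** M = mat 1" using assms by (auto simp: invertible_def)
  then have "v = N *v (M *v v)" by (simp add: matrix_vector_mul_assoc)
  then show "v = 0" if "M *v v = 0" using that by simp
qed simp

lemma cvec_eq_0_iff [simp]: "cvec x = 0 \<longleftrightarrow> x = 0"
  by (simp add: vec_eq_iff cvec_def)

lemma proj_class_eq_iff:
  assumes "v \<noteq> 0"
  shows "proj_class w = proj_class v \<longleftrightarrow> (\<exists>c. c \<noteq> 0 \<and> w = c *s v)"
proof
  assume eq: "proj_class w = proj_class v"
  then have "w \<in> vec.span {v}" "v \<in> vec.span {w}"
    unfolding proj_class_def by (metis insertI1 vec.span_base)+
  then obtain c c' where "w = c *s v" "v = c' *s w"
    unfolding vec.span_singleton by blast
  moreover from this have "c \<noteq> 0" using assms by auto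
  ultimately show "\<exists>c. c \<noteq> 0 \<and> w = c *s v" by blast
next
  assume "\<exists>c. c \<noteq> 0 \<and> w = c *s v"
  then obtain c where c: "c \<noteq> 0" "w = c *s v" by blast
  have "k *s v \<in> range (\<lambda>k. k *s w)" for k
    using c by (intro image_eqI[of _ _ "k / c"]) (auto simp: vector_smult_assoc)
  then show "proj_class w = proj_class v"
    using c unfolding proj_class_def vec.span_singleton by (auto simp: vector_smult_assoc)
qed

lemma mp_eval_scale:
  assumes "mp_homogeneous d F"
  shows "mp_eval F (c *s v) = c ^ d * mp_eval F v"
  unfolding mp_eval_def sum_distrib_left
proof (rule sum.cong)
  fix m assume "m \<in> Poly_Mapping.keys F"
  then have "(\<Prod>i\<in>UNIV. c ^ Poly_Mapping.lookup m i) = c ^ d"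
    using assms by (simp add: mp_homogeneous_def flip: power_sum)
  then show "Poly_Mapping.lookup F m * (\<Prod>i\<in>UNIV. ((c *s v) $ i) ^ Poly_Mapping.lookup m i) =
      c ^ d * (Poly_Mapping.lookup F m * (\<Prod>i\<in>UNIV. (v $ i) ^ Poly_Mapping.lookup m i))"
    by (simp add: power_mult_distrib prod.distrib)
qed simp

definition vec_cnj :: "complex ^ 'n \<Rightarrow> complex ^ 'n" where
  "vec_cnj v = (\<chi> i. cnj (v $ i))"

lemma mp_eval_vec_cnj:
  assumes "\<And>m. Poly_Mapping.lookup F m \<in> \<real>"
  shows "mp_eval F (vec_cnj v) = cnj (mp_eval F v)"
proof -
  have "cnj (Poly_Mapping.lookup F m) = Poly_Mapping.lookup F m" for m
    using assms by (simp add: Reals_cnj_iff)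
  then show ?thesis by (simp add: mp_eval_def vec_cnj_def)
qed

lemma affine_coords_nz:
  fixes A :: "real ^ 3 ^ 3"
  assumes "invertible A" "(x, y, z) \<noteq> (0, 0, 0)"
  shows "cmat A *v vector [x, y, z] \<noteq> 0"
  using assms(2) invertible_mult_eq_0_iff[OF invertible_cmat[OF assms(1)], of "vector [x, y, z]"]
  by (auto simp: vec_eq_iff forall_3)

text \<open>Collects what the later argument needs from the equation of the curve. The function
  \<open>h\<close> is the form \<open>F\<close> composed with the lift \<open>H\<close> of the
  chart. The lift never vanishes, and homogeneity makes the vanishing of \<open>F\<close>
  independent of the representative; real coefficients give the compatibility with
  conjugation.\<close>

lemma affine_curve_equation:
  assumes "real_plane_curve V" "invertible A"
  obtains h :: "complex ^ 2 \<Rightarrow> complex" where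
    "affine_part A V = {p. h p = 0}"
    "continuous_on UNIV h"
    "\<And>p v. (\<lambda>t. h (p + t *s v)) holomorphic_on UNIV"
    "\<And>p. h (vec_cnj p) = cnj (h p)"
proof -
  obtain F :: "(3, complex) mpolynomial" and d
    where F: "mp_homogeneous d F" "\<And>m. Poly_Mapping.lookup F m \<in> \<real>"
      and V: "V = {proj_class v | v. v \<noteq> 0 \<and> mp_eval F v = 0}"
    using assms(1) unfolding real_plane_curve_def by blast
  define H where "H p = cmat A *v vector [p $ 1, p $ 2, 1]" for p :: "complex ^ 2"
  have H_nth: "H p $ i = cmat A $ i $ 1 * p $ 1 + cmat A $ i $ 2 * p $ 2 + cmat A $ i $ 3" for p i
    by (simp add: H_def matrix_vector_mult_def sum_3)
  have H_nz: "H p \<noteq> 0" for p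
    unfolding H_def by (rule affine_coords_nz[OF assms(2)]) simp
  have mem_V: "proj_class v \<in> V \<longleftrightarrow> mp_eval F v = 0" if "v \<noteq> 0" for v
  proof
    assume "proj_class v \<in> V"
    then obtain w where w: "w \<noteq> 0" "mp_eval F w = 0" "proj_class v = proj_class w"
      using V by blast
    then show "mp_eval F v = 0"
      using proj_class_eq_iff[of w v] mp_eval_scale[OF F(1)] by auto
  qed (use that V in blast)
  show thesis
  proof (rule that[of "\<lambda>p. mp_eval F (H p)"])
    show "affine_part A V = {p. mp_eval F (H p) = 0}"
      unfolding affine_part_def affine_chart_def using mem_V[OF H_nz] by (simp add: H_def)
    show "continuous_on UNIV (\<lambda>p. mp_eval F (H p))"
      unfolding mp_eval_def H_nth by (intro continuous_intros)
    show "(\<lambda>t. mp_eval F (H (p + t *s v))) holomorphic_on UNIV" for p v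
      unfolding mp_eval_def H_nth vector_add_component vector_smult_component
      by (intro holomorphic_intros)
    have "H (vec_cnj p) = vec_cnj (H p)" for p
      by (simp add: vec_eq_iff H_nth vec_cnj_def cmat_def cvec_def)
    then show "mp_eval F (H (vec_cnj p)) = cnj (mp_eval F (H p))" for p
      by (simp add: mp_eval_vec_cnj F(2))
  qed
qed

text \<open>Pull a real representative of \<open>L0\<close> back through \<open>A\<close>. Its last
  coordinate must vanish: otherwise dividing by it would place \<open>L0\<close> in the affine
  chart, hence off \<open>L1\<close>. The first two coordinates form the direction
  \<open>u\<close>.\<close>

lemma cone_line_eq_span:
  assumes L0: "real_proj_point L0" "L0 \<in> L1" and A: "affine_coordinates A L1"
  obtains u :: "real ^ 2" where "u \<noteq> 0" "cone_line A L0 = vec.span {cvec u}"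
proof -
  have inv: "invertible A" and chart: "range (affine_chart A) = proj_plane - L1"
    using A by (auto simp: affine_coordinates_def)
  obtain w where w: "w \<noteq> 0" "L0 = proj_class (cvec w)"
    using L0(1) by (auto simp: real_proj_point_def)
  obtain B where "A ** B = mat 1" using inv by (auto simp: invertible_def)
  then have z: "A *v (B *v w) = w" by (simp add: matrix_vector_mul_assoc)
  define z where "z = B *v w"
  have z_nz: "z \<noteq> 0" using w(1) z by (auto simp: z_def)
  have cz: "cmat A *v cvec z = cvec w" using z by (simp add: cmat_mult_cvec z_def)
  have z3: "z $ 3 = 0"
  proof (rule ccontr)
    assume z3: "z $ 3 \<noteq> 0"
    define p :: "complex ^ 2" where "p = vector [of_real (z $ 1 / z $ 3), of_real (z $ 2 / z $ 3)]"
    have "vector [p $ 1, p $ 2, 1] = of_real (1 / z $ 3) *s cvec z"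
      using z3 by (simp add: vec_eq_iff forall_3 p_def cvec_def)
    then have "cmat A *v vector [p $ 1, p $ 2, 1] = of_real (1 / z $ 3) *s cvec w"
      using cz by (simp add: vector_scalar_commute)
    then have "affine_chart A p = L0"
      unfolding affine_chart_def w(2) using z3 w(1) by (subst proj_class_eq_iff) auto
    then show False using chart L0(2) by blast
  qed
  define u :: "real ^ 2" where "u = vector [z $ 1, z $ 2]"
  have u_nz: "u \<noteq> 0" using z_nz z3 by (auto simp: u_def vec_eq_iff forall_3 forall_2)
  have "point_at_infinity A v = L0 \<longleftrightarrow> (\<exists>c. c \<noteq> 0 \<and> v = c *s cvec u)" for v
  proof -
    have "cmat A *v vector [v $ 1, v $ 2, 0] = c *s cvec w \<longleftrightarrow> v = c *s cvec u" for c
    proof -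
      have "cmat A *v vector [v $ 1, v $ 2, 0] = c *s cvec w \<longleftrightarrow>
          cmat A *v (vector [v $ 1, v $ 2, 0] - c *s cvec z) = 0"
        using cz by (simp add: matrix_vector_mult_diff_distrib vector_scalar_commute)
      also have "\<dots> \<longleftrightarrow> vector [v $ 1, v $ 2, 0] = c *s cvec z"
        by (simp add: invertible_mult_eq_0_iff[OF invertible_cmat[OF inv]])
      also have "\<dots> \<longleftrightarrow> v = c *s cvec u"
        using z3 by (simp add: vec_eq_iff forall_3 forall_2 u_def cvec_def)
      finally show ?thesis .
    qed
    then show ?thesis
      unfolding point_at_infinity_def w(2) using w(1) by (simp add: proj_class_eq_iff)
  qed
  \<comment> \<open>The disjunct \<open>v = 0\<close> supplies the missing scalar 0.\<close>
  then have "v = 0 \<or> point_at_infinity A v = L0 \<longleftrightarrow> (\<exists>c. v = c *s cvec u)" for v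
    by (cases "v = 0") (auto intro: exI[of _ 0])
  then have "cone_line A L0 = vec.span {cvec u}"
    unfolding cone_line_def vec.span_singleton by auto
  then show thesis using that u_nz by blast
qed

section \<open>Differentials of polynomials and tangent spaces\<close>

text \<open>The differential of \<open>g\<close> at \<open>p\<close> applied to \<open>v\<close>, by
  the power rule. At exponent 0 the truncated subtraction is harmless, since the factor
  \<open>of_nat 0\<close> kills the term. The explicit sum makes continuity in \<open>p\<close> and
  homogeneity in \<open>v\<close> immediate.\<close>

definition mp_dir_deriv :: "(2, complex) mpolynomial \<Rightarrow> complex ^ 2 \<Rightarrow> complex ^ 2 \<Rightarrow> complex" where
  "mp_dir_deriv g p v =
     (\<Sum>m\<in>Poly_Mapping.keys g. Poly_Mapping.lookup g m *
        (of_nat (Poly_Mapping.lookup m 1) * p $ 1 ^ (Poly_Mapping.lookup m 1 - 1) * v $ 1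
           * p $ 2 ^ Poly_Mapping.lookup m 2 +
         of_nat (Poly_Mapping.lookup m 2) * p $ 2 ^ (Poly_Mapping.lookup m 2 - 1) * v $ 2
           * p $ 1 ^ Poly_Mapping.lookup m 1))"

lemma mp_eval_2:
  "mp_eval g p = (\<Sum>m\<in>Poly_Mapping.keys g. Poly_Mapping.lookup g m *
     (p $ 1 ^ Poly_Mapping.lookup m 1 * p $ 2 ^ Poly_Mapping.lookup m 2))"
  for p :: "'a::comm_ring_1 ^ 2"
  by (simp add: mp_eval_def UNIV_2)

lemma has_field_derivative_mp_eval_line:
  "((\<lambda>t. mp_eval g (p + t *s v)) has_field_derivative mp_dir_deriv g (p + t *s v) v) (at t)"
proof -
  have "((\<lambda>t. p $ i + t * v $ i) has_field_derivative v $ i) (at t)" for i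
    by (auto intro!: derivative_eq_intros)
  note DERIV_power[OF this]
  from DERIV_mult[OF this this]
  have "((\<lambda>t. (p $ 1 + t * v $ 1) ^ j * (p $ 2 + t * v $ 2) ^ k) has_field_derivative
      of_nat j * (p $ 1 + t * v $ 1) ^ (j - 1) * v $ 1 * (p $ 2 + t * v $ 2) ^ k +
      of_nat k * (p $ 2 + t * v $ 2) ^ (k - 1) * v $ 2 * (p $ 1 + t * v $ 1) ^ j) (at t)" for j k
    by (rule DERIV_cong) (simp add: algebra_simps)
  then show ?thesis
    unfolding mp_eval_2 mp_dir_deriv_def vector_add_component vector_smult_component
    by (intro DERIV_sum DERIV_cmult)
qed

lemma mp_dir_deriv_scale: "mp_dir_deriv g p (c *s v) = c * mp_dir_deriv g p v"
  by (simp add: mp_dir_deriv_def sum_distrib_left algebra_simps)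

lemma tangent_space_eq:
  "tangent_space S P = {v. \<forall>g\<in>vanishing_ideal S. mp_dir_deriv g P v = 0}"
  using DERIV_imp_deriv[OF has_field_derivative_mp_eval_line[where t = 0]]
  by (simp add: tangent_space_def)


section \<open>Real branches at a maximum of a linear form\<close>

lemma eval_fps_of_real_in_Reals:
  fixes f :: "complex fps"
  assumes "\<And>n. fps_nth f n \<in> \<real>" "ereal (norm t) < fps_conv_radius f"
  shows "eval_fps f (of_real t) \<in> \<real>"
proof -
  have "(\<lambda>n. fps_nth f n * of_real t ^ n) sums eval_fps f (of_real t)"
    unfolding eval_fps_def using assms(2) by (intro summable_sums summable_fps) simp
  then have "(\<lambda>n. Im (fps_nth f n * of_real t ^ n)) sums Im (eval_fps f (of_real t))"
    by (rule sums_Im)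
  moreover have "Im (fps_nth f n * of_real t ^ n) = 0" for n
    using assms(1)[of n] by (metis Reals_mult Reals_of_real Reals_power complex_is_Real_iff)
  ultimately have "(\<lambda>_. 0) sums Im (eval_fps f (of_real t))" by (simp only:)
  from sums_unique2[OF this sums_zero] have "Im (eval_fps f (of_real t)) = 0" .
  then show ?thesis by (simp add: complex_is_Real_iff)
qed

text \<open>Real parameters on an open interval around 0 trace a connected path in the real points
  through \<open>x\<close>, so it stays in \<open>C\<close>. The form \<open>w\<close> has an
  interior maximum along it at parameter 0, hence derivative 0 there; the velocity is the vector of
  first coefficients.\<close>

lemma real_branch_tangent_in_kernel:
  fixes w x :: "real ^ 2" and g :: "complex fps ^ 2"
  assumes g: "branch_param S (cvec x) g" and real: "\<And>i n. fps_nth (g $ i) n \<in> \<real>"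
    and C: "C \<in> components (real_points S)" "x \<in> C" and max: "\<And>y. y \<in> C \<Longrightarrow> w \<bullet> y \<le> w \<bullet> x"
  shows "w \<bullet> (\<chi> i. Re (fps_nth (g $ i) 1)) = 0"
proof -
  obtain r where conv: "\<And>i. fps_conv_radius (g $ i) > 0"
    and centre: "\<And>i. fps_nth (g $ i) 0 = cvec x $ i"
    and r: "r > 0" "curve_germ g ` ball 0 r \<subseteq> S"
    using g unfolding branch_param_def by blast
  have "\<exists>q. 0 < q \<and> ereal q < fps_conv_radius (g $ i)" for i
    using ereal_dense2[OF conv[of i]] by auto
  then obtain q where q: "\<And>i. 0 < q i" "\<And>i. ereal (q i) < fps_conv_radius (g $ i)"
    by metis
  \<comment> \<open>The radii of convergence may be infinite, hence the detour through the finite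
    \<open>q i\<close>.\<close>
  define \<rho> where "\<rho> = min r (min (q 1) (q 2))"
  have \<rho>: "0 < \<rho>" "\<rho> \<le> r" using r(1) q(1) by (auto simp: \<rho>_def)
  have "\<rho> \<le> q i" for i using exhaust_2[of i] by (auto simp: \<rho>_def)
  \<comment> \<open>The type of \<open>t\<close> stays general because both real and complex
    parameters occur below.\<close>
  then have in_conv: "ereal (norm t) < fps_conv_radius (g $ i)" if "norm t < \<rho>" for i and t :: "'a::real_normed_vector"
    using q(2)[of i] that by (meson ereal_less_eq(3) le_less_trans less_le_trans less_imp_le)
  define y where "y t = (\<chi> i. Re (eval_fps (g $ i) (of_real t)))" for t :: real
  have deriv: "((\<lambda>t. Re (eval_fps (g $ i) (of_real t))) has_real_derivative
      Re (eval_fps (fps_deriv (g $ i)) (of_real t))) (at t)" if "\<bar>t\<bar> < \<rho>" for i t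
  proof -
    have "(eval_fps (g $ i) has_field_derivative eval_fps (fps_deriv (g $ i)) (of_real t)) (at (of_real t))"
      using in_conv[of "of_real t :: complex"] that by (intro has_field_derivative_eval_fps) auto
    then have "((\<lambda>t. eval_fps (g $ i) (of_real t)) has_vector_derivative
        eval_fps (fps_deriv (g $ i)) (of_real t)) (at t)"
      by (rule has_vector_derivative_real_field)
    from bounded_linear.has_vector_derivative[OF bounded_linear_Re this]
    show ?thesis by (simp add: has_real_derivative_iff_has_vector_derivative)
  qed
  have y0: "y 0 = x"
    by (simp add: y_def vec_eq_iff eval_fps_at_0 centre cvec_def)
  have "y ` {-\<rho><..<\<rho>} \<subseteq> C"
  proof (rule components_maximal[OF C(1)])
    have "continuous_on {-\<rho><..<\<rho>} y"
      unfolding y_def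
      by (rule continuous_on_vec_lambda, rule DERIV_continuous_on,
          rule has_field_derivative_at_within, rule deriv) auto
    then show "connected (y ` {-\<rho><..<\<rho>})"
      by (intro connected_continuous_image) auto
    show "y ` {-\<rho><..<\<rho>} \<subseteq> real_points S"
    proof clarify
      fix t assume t: "t \<in> {-\<rho><..<\<rho>}"
      have "of_real (Re (eval_fps (g $ i) (of_real t))) = eval_fps (g $ i) (of_real t)" for i
        using eval_fps_of_real_in_Reals[of "g $ i" t] real in_conv[of t] t by auto
      then have "cvec (y t) = curve_germ g (of_real t)"
        by (simp add: vec_eq_iff cvec_def y_def curve_germ_def)
      also have "\<dots> \<in> S" using r(2) t \<rho>(2) by auto
      finally show "y t \<in> real_points S" by (simp add: real_points_def)
    qed
    show "C \<inter> y ` {-\<rho><..<\<rho>} \<noteq> {}"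
      using \<rho>(1) C(2) y0 by (auto intro!: image_eqI[of _ _ 0])
  qed
  then have "y t \<in> C" if "\<bar>t\<bar> < \<rho>" for t
    using that by (simp add: image_subset_iff abs_less_iff minus_less_iff)
  then have "\<forall>t. \<bar>0 - t\<bar> < \<rho> \<longrightarrow> w \<bullet> y t \<le> w \<bullet> y 0"
    using max y0 by simp
  moreover have "((\<lambda>t. w \<bullet> y t) has_real_derivative w \<bullet> (\<chi> i. Re (fps_nth (g $ i) 1))) (at 0)"
  proof -
    have "((\<lambda>t. \<Sum>i\<in>UNIV. w $ i * Re (eval_fps (g $ i) (of_real t))) has_real_derivative
        (\<Sum>i\<in>UNIV. w $ i * Re (eval_fps (fps_deriv (g $ i)) (of_real 0)))) (at 0)"
      by (intro DERIV_sum DERIV_cmult deriv) (use \<rho> in simp)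
    then show ?thesis by (simp add: inner_vec_def y_def eval_fps_at_0)
  qed
  ultimately show ?thesis using DERIV_local_max \<rho>(1) by blast
qed

text \<open>The equivalence relation is restricted to branch parametrizations, so every member of a
  class is one.\<close>

lemma real_branch_representative:
  assumes "B \<in> real_branches S P"
  obtains g :: "complex fps ^ 2" where "g \<in> B" "branch_param S P g" "\<And>i n. fps_nth (g $ i) n \<in> \<real>"
proof -
  obtain g :: "complex fps ^ 2" where "g \<in> B" "\<And>i n. fps_nth (g $ i) n \<in> \<real>" "B \<in> branches S P"
    using assms by (auto simp: real_branches_def)
  then show thesis using that by (auto simp: branches_def elim!: quotientE)
qed

text \<open>The vector \<open>w\<close> is \<open>u\<close> turned by a right angle, so its kernel
  is the line of \<open>u\<close>. All real branches at \<open>x\<close> are then tangent to that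
  one line, whereas two transversal tangents would span the plane.\<close>

lemma not_ordinary_at_maximum:
  fixes u w x :: "real ^ 2"
  assumes u: "u \<noteq> 0" and w: "w = vector [- u $ 2, u $ 1]"
    and C: "C \<in> components (real_points S)" "x \<in> C" and max: "\<And>y. y \<in> C \<Longrightarrow> w \<bullet> y \<le> w \<bullet> x"
  shows "\<not> ordinary_real_multiple_point S (cvec x)"
proof
  assume ord: "ordinary_real_multiple_point S (cvec x)"
  have tangent: "\<exists>g\<in>B. param_tangent g \<subseteq> vec.span {cvec u}" if B: "B \<in> real_branches S (cvec x)" for B
  proof -
    obtain g :: "complex fps ^ 2" where g: "g \<in> B" "branch_param S (cvec x) g" and real: "\<And>i n. fps_nth (g $ i) n \<in> \<real>"
      using real_branch_representative[OF B] by blast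
    define a :: "real ^ 2" where "a = (\<chi> i. Re (fps_nth (g $ i) 1))"
    have "w \<bullet> a = 0"
      unfolding a_def by (rule real_branch_tangent_in_kernel[OF g(2) real C max])
    then have det: "u $ 1 * a $ 2 = u $ 2 * a $ 1"
      \<comment> \<open>The determinant of \<open>u\<close> and \<open>a\<close> vanishes; dividing
        by a non-zero coordinate of \<open>u\<close> gives the factor \<open>k\<close>.\<close>
      by (simp add: w inner_vec_def sum_2)
    have "\<exists>k. a = k *\<^sub>R u"
    proof (cases "u $ 1 = 0")
      case True
      then have "u $ 2 \<noteq> 0" using u by (auto simp: vec_eq_iff forall_2)
      then show ?thesis using True det
        by (intro exI[of _ "a $ 2 / u $ 2"]) (auto simp: vec_eq_iff forall_2)
    next
      case False
      then show ?thesis using det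
        by (intro exI[of _ "a $ 1 / u $ 1"]) (auto simp: vec_eq_iff forall_2 field_simps)
    qed
    then obtain k where "a = k *\<^sub>R u" ..
    then have "cvec a = of_real k *s cvec u"
      by (simp add: vec_eq_iff cvec_def)
    moreover have "cvec a = (\<chi> i. fps_nth (g $ i) 1)"
      using real by (simp add: vec_eq_iff cvec_def a_def)
    \<comment> \<open>Smoothness identifies the tangent with the span of the velocity. At a cusp the
      velocity would be 0 and say nothing about the tangent.\<close>
    moreover have "param_mult g = 1"
      using ord B g(1) by (auto simp: ordinary_real_multiple_point_def smooth_branch_def)
    ultimately have "param_tangent g = vec.span {of_real k *s cvec u}"
      by (simp add: param_tangent_def)
    also have "\<dots> \<subseteq> vec.span {cvec u}"
      by (intro vec.span_minimal) (auto intro: vec.span_scale vec.span_base)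
    finally show ?thesis using g(1) by blast
  qed
  obtain B B' where B: "B \<in> real_branches S (cvec x)" "B' \<in> real_branches S (cvec x)"
    and "transversal_branches B B'"
    using ord unfolding ordinary_real_multiple_point_def pairwise_def by blast
  then obtain g g' where "vec.span (param_tangent g \<union> param_tangent g') = UNIV"
    "param_tangent g \<subseteq> vec.span {cvec u}" "param_tangent g' \<subseteq> vec.span {cvec u}"
    using tangent[OF B(1)] tangent[OF B(2)] unfolding transversal_branches_def by blast
  then have "vec.span {cvec u} = UNIV"
    by (metis Un_subset_iff top.extremum_uniqueI vec.span_minimal vec.subspace_span)
  then have "vec.dim (UNIV :: (complex ^ 2) set) \<le> 1"
    using vec.dim_le_card[of UNIV "{cvec u}"] by simp
  then show False by (simp add: card_cart_basis)
qed

section \<open>Tangent direction at a maximum\<close>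

text \<open>On a line parallel to \<open>u\<close>, the roots of \<open>h\<close> are exactly the
  points of \<open>S\<close>, which gives existence. If \<open>u\<close> were not tangent, some
  \<open>g\<close> in the ideal would have a simple root at \<open>x\<close> along \<open>u\<close>,
  which gives uniqueness. The resulting real path would leave \<open>x\<close> with increasing
  \<open>w\<close>.\<close>

lemma direction_tangent_at_maximum:
  fixes u w x :: "real ^ 2"
  assumes h: "S = {p. h p = 0}" "continuous_on UNIV h"
      "\<And>p v. (\<lambda>t. h (p + t *s v)) holomorphic_on UNIV"
      "\<And>p. h (vec_cnj p) = cnj (h p)"
    and w: "w \<noteq> 0" "w \<bullet> u = 0"
    and C: "C \<in> components (real_points S)" "x \<in> C" and max: "\<And>y. y \<in> C \<Longrightarrow> w \<bullet> y \<le> w \<bullet> x"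
  shows "cvec u \<in> tangent_space S (cvec x)"
proof (rule ccontr)
  assume "cvec u \<notin> tangent_space S (cvec x)"
  then obtain g where g: "\<And>p. h p = 0 \<Longrightarrow> mp_eval g p = 0"
    and dg: "mp_dir_deriv g (cvec x) (cvec u) \<noteq> 0"
    using h(1) by (auto simp: tangent_space_eq vanishing_ideal_def)
  \<comment> \<open>The real \<open>s\<close> selects a line parallel to \<open>u\<close>, and the
    complex \<open>t\<close> is the position on it. With \<open>s\<close> real, conjugating
    \<open>t\<close> conjugates the point.\<close>
  define p where "p s t = cvec x + of_real s *s cvec w + t *s cvec u" for s :: real and t :: complex
  have p_nth: "p s t $ i = of_real (x $ i) + of_real s * of_real (w $ i) + t * of_real (u $ i)" for s t i
    by (simp add: p_def cvec_def)
  have p_cont: "continuous_on UNIV (\<lambda>q. p (fst q) (snd q))"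
    unfolding p_def vector_scalar_mult_def by (intro continuous_intros continuous_on_vec_lambda)
  have x: "h (cvec x) = 0"
    using C h(1) in_components_subset by (fastforce simp: real_points_def)
  obtain \<delta> and \<tau> :: "real \<Rightarrow> real" where \<delta>: "0 < \<delta>"
    and \<tau>: "continuous_on {0..\<delta>} \<tau>" "\<tau> 0 = 0"
      "\<And>s. s \<in> {0..\<delta>} \<Longrightarrow> h (p s (of_real (\<tau> s))) = 0"
  proof (rule real_root_path[of "\<lambda>s t. h (p s t)" "\<lambda>s t. mp_eval g (p s t)"
        "\<lambda>s t. mp_dir_deriv g (p s t) (cvec u)"])
    show "continuous_on UNIV (\<lambda>q. h (p (fst q) (snd q)))"
      by (rule continuous_on_compose2[OF h(2) p_cont]) simp
    show "(\<lambda>t. h (p s t)) holomorphic_on UNIV" for s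
      unfolding p_def by (rule h(3))
    show "h (p s (cnj t)) = 0" if "h (p s t) = 0" for s t
    proof -
      have "p s (cnj t) = vec_cnj (p s t)"
        by (simp add: vec_eq_iff vec_cnj_def p_nth)
      then show ?thesis using that by (simp add: h(4))
    qed
    show "h (p 0 0) = 0" using x by (simp add: p_def)
    show "continuous_on UNIV (\<lambda>s. mp_eval g (p s t))" for t
      unfolding mp_eval_def p_nth by (intro continuous_intros)
    show "((\<lambda>t. mp_eval g (p s t)) has_field_derivative mp_dir_deriv g (p s t) (cvec u)) (at t)" for s t
      unfolding p_def by (rule has_field_derivative_mp_eval_line)
    show "continuous_on UNIV (\<lambda>q. mp_dir_deriv g (p (fst q) (snd q)) (cvec u))"
      unfolding mp_dir_deriv_def p_nth by (intro continuous_intros)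
    show "mp_dir_deriv g (p 0 0) (cvec u) \<noteq> 0" using dg by (simp add: p_def)
  qed (use g in auto)
  \<comment> \<open>The path starts at \<open>x\<close> because \<open>\<tau> 0 = 0\<close>, so it
    stays in the component \<open>C\<close>.\<close>
  define y where "y s = x + s *\<^sub>R w + \<tau> s *\<^sub>R u" for s
  have "y ` {0..\<delta>} \<subseteq> C"
  proof (rule components_maximal[OF C(1)])
    show "connected (y ` {0..\<delta>})"
      unfolding y_def by (intro connected_continuous_image continuous_intros \<tau>(1)) auto
    have "cvec (y s) = p s (of_real (\<tau> s))" for s
      by (simp add: vec_eq_iff p_nth y_def cvec_def)
    then show "y ` {0..\<delta>} \<subseteq> real_points S"
      using \<tau>(3) h(1) by (auto simp: real_points_def)
    show "C \<inter> y ` {0..\<delta>} \<noteq> {}"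
      using C(2) \<tau>(2) \<delta> by (auto intro!: image_eqI[of _ _ 0] simp: y_def)
  qed
  then have "y \<delta> \<in> C" using \<delta> by auto
  then have "w \<bullet> y \<delta> \<le> w \<bullet> x" by (rule max)
  \<comment> \<open>The shift along \<open>u\<close> is invisible to \<open>w\<close> by
    orthogonality.\<close>
  moreover have "w \<bullet> y \<delta> = w \<bullet> x + \<delta> * (w \<bullet> w)"
    by (simp add: y_def inner_add_right w(2))
  ultimately show False using mult_pos_pos[OF \<delta>, of "w \<bullet> w"] w(1) by simp
qed

text \<open>Turns membership of the direction into the equality of lines that defines the polar
  variety.\<close>

lemma tangent_space_eq_span:
  assumes "vec.dim (tangent_space S P) = 1" "v \<in> tangent_space S P" "v \<noteq> 0"
  shows "tangent_space S P = vec.span {v}"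
proof
  show "tangent_space S P \<subseteq> vec.span {v}"
    by (rule vec.card_ge_dim_independent) (use assms in auto)
  show "vec.span {v} \<subseteq> tangent_space S P"
    using assms(2) by (auto simp: vec.span_singleton tangent_space_eq mp_dir_deriv_scale)
qed

theorem proposition3p1:
  fixes V L1 :: "proj_pt set" and L0 :: proj_pt and A :: "real ^ 3 ^ 3"
    and S :: "(complex ^ 2) set"
  assumes "real_plane_curve V"
    and "real_proj_point L0" and "real_proj_line L1" and "L0 \<in> L1"
    and "affine_coordinates A L1"
    and "S = affine_part A V"
    and "real_points S \<noteq> {}" and "compact (real_points S)"
    and "\<forall>x\<in>real_points S - real_points (nonsingular_points S).
           ordinary_real_multiple_point S (cvec x)"
  shows "\<forall>C\<in>components (real_points S).
           \<exists>x\<in>C. x \<in> real_points (nonsingular_points S) \<and>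
                 x \<in> real_points (polar_variety A L0 S)"
proof
  fix C assume C: "C \<in> components (real_points S)"
  have "invertible A" using assms(5) by (simp add: affine_coordinates_def)
  then obtain h where h: "S = {p. h p = 0}" "continuous_on UNIV h"
      "\<And>p v. (\<lambda>t. h (p + t *s v)) holomorphic_on UNIV"
      "\<And>p. h (vec_cnj p) = cnj (h p)"
    using affine_curve_equation[OF assms(1)] unfolding assms(6) by metis
  obtain u where u: "u \<noteq> 0" "cone_line A L0 = vec.span {cvec u}"
    using cone_line_eq_span[OF assms(2,4,5)] .
  define w :: "real ^ 2" where "w = vector [- u $ 2, u $ 1]"
  have w: "w \<noteq> 0" "w \<bullet> u = 0"
    using u(1) by (auto simp: w_def vec_eq_iff forall_2 inner_vec_def sum_2)
  \<comment> \<open>Components of a compact set are compact, so the maximum is attained.\<close>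
  have "\<exists>x\<in>C. \<forall>y\<in>C. w \<bullet> y \<le> w \<bullet> x"
    by (intro continuous_attains_sup compact_components[OF assms(8) C] in_components_nonempty[OF C]
        continuous_intros)
  then obtain x where x: "x \<in> C" and max: "\<And>y. y \<in> C \<Longrightarrow> w \<bullet> y \<le> w \<bullet> x"
    by blast
  have "x \<in> real_points S" using C x in_components_subset by blast
  then have ns: "x \<in> real_points (nonsingular_points S)"
    using assms(9) not_ordinary_at_maximum[OF u(1) w_def C x max] by blast
  have "tangent_space S (cvec x) = vec.span {cvec u}"
    using ns u(1) direction_tangent_at_maximum[OF h w C x max]
    by (intro tangent_space_eq_span) (simp_all add: real_points_def nonsingular_points_def)
  then show "\<exists>x\<in>C. x \<in> real_points (nonsingular_points S) \<and>
      x \<in> real_points (polar_variety A L0 S)"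
    using x ns u(2) by (auto simp: real_points_def polar_variety_def)
qed

end
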